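(* The Coombs procedure prevents social disappointment: for every finite set $A$ of alternatives with $|A|\ge 3$, every positive integer $n$, every $(A,n)$-profile $P$ and every $x\in A$, if at least $n/2$ of the $n$ voters rank $x$ last in $P$, then $x$ is not a winner of the Coombs procedure at $P$.
   Context: A ballot is a linear ordering of the finite set $A$ of alternatives (a strict ranking without ties). An $(A,n)$-profile $P$ is an $n$-tuple of ballots, one for each voter in $\{1,\dots,n\}$. Coombs procedure: for a nonempty $S\subseteq A$, let $P|_S$ be the profile obtained by restricting each ballot to $S$, and let $V_C(P|_S)$ be the set of all alternatives of $S$ except those with the most last-place votes (among $S$), with the convention that $V_C(P|_S)=S$ if all alternatives of $S$ have the same number of last-place votes. Put $W_0=A$ and $W_{k+1}=V_C(P|_{W_k})$. This decreasing sequence of nonempty sets becomes constant, and the set of winners of the Coombs procedure at $P$ is its eventual value, $W_{|A|}$. *)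

theory Defs
  imports Complex_Main
begin

text \<open>
  A ballot is a linear order on the set of alternatives, as a relation:
  \<open>(a, b) \<in> r\<close> means that \<open>a\<close> is ranked at least as high as \<open>b\<close> on the ballot \<open>r\<close>.
\<close>

type_synonym 'a ballot = "'a rel"

text \<open>The voters are \<open>1, \<dots>, n\<close>; values of a profile outside \<open>{1..n}\<close> play no role.\<close>

type_synonym 'a profile = "nat \<Rightarrow> 'a ballot"

definition is_profile :: "'a set \<Rightarrow> nat \<Rightarrow> 'a profile \<Rightarrow> bool" where
  "is_profile A n P \<longleftrightarrow> (\<forall>i\<in>{1..n}. linear_order_on A (P i))"

definition restrict_profile :: "'a profile \<Rightarrow> 'a set \<Rightarrow> 'a profile" where
  "restrict_profile P S = (\<lambda>i. Restr (P i) S)"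

definition ranked_last :: "'a set \<Rightarrow> 'a ballot \<Rightarrow> 'a \<Rightarrow> bool" where
  "ranked_last S r x \<longleftrightarrow> x \<in> S \<and> (\<forall>y\<in>S. (y, x) \<in> r)"

definition last_votes :: "'a set \<Rightarrow> nat \<Rightarrow> 'a profile \<Rightarrow> 'a \<Rightarrow> nat" where
  "last_votes S n P x = card {i \<in> {1..n}. ranked_last S (P i) x}"

text \<open>In the following definition, \<open>P\<close> is a profile on the set of alternatives \<open>S\<close>.\<close>

definition V_C :: "'a set \<Rightarrow> nat \<Rightarrow> 'a profile \<Rightarrow> 'a set" where
  "V_C S n P =
    (if \<forall>x\<in>S. \<forall>y\<in>S. last_votes S n P x = last_votes S n P y then S
     else S - {x \<in> S. \<forall>y\<in>S. last_votes S n P y \<le> last_votes S n P x})"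

primrec coombs_seq :: "'a set \<Rightarrow> nat \<Rightarrow> 'a profile \<Rightarrow> nat \<Rightarrow> 'a set" where
  "coombs_seq A n P 0 = A"
| "coombs_seq A n P (Suc k) =
    V_C (coombs_seq A n P k) n (restrict_profile P (coombs_seq A n P k))"

definition coombs_winners :: "'a set \<Rightarrow> nat \<Rightarrow> 'a profile \<Rightarrow> 'a set" where
  "coombs_winners A n P = coombs_seq A n P (card A)"

end

theory Submission
  imports Defs
begin

text \<open>The alternative \<open>x\<close> already falls in the first round, and the Coombs
  sequence only shrinks (\<open>antimono_coombs_seq\<close>), so it never returns. Each voter casts
  at most one last-place vote (\<open>sum_last_votes_le\<close>). Hence no alternative can have more
  such votes than \<open>x\<close>, which has at least half of them; and an overall tie, the only
  case in which \<open>V_C\<close> spares \<open>x\<close>, would take at least 3n/2 votes. This is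
  \<open>V_C_drops_majority_loser\<close>.\<close>

lemma V_C_subset: "V_C S n P \<subseteq> S"
  unfolding V_C_def by (simp split: if_split)

lemma antimono_coombs_seq: "antimono (coombs_seq A n P)"
  by (rule decseq_SucI) (simp add: V_C_subset)

text \<open>Being ranked last in \<open>S\<close> depends only on pairs inside \<open>S\<close>, so
  the restriction built into each round can be ignored.\<close>

lemma last_votes_restrict_profile: "last_votes S n (restrict_profile P S) = last_votes S n P"
proof -
  have "ranked_last S (Restr r S) x = ranked_last S r x" for r x
    by (auto simp: ranked_last_def)
  then show ?thesis
    by (simp add: last_votes_def restrict_profile_def fun_eq_iff)
qed

lemma V_C_restrict_profile: "V_C S n (restrict_profile P S) = V_C S n P"
  unfolding V_C_def last_votes_restrict_profile ..

text \<open>By antisymmetry no ballot ranks two alternatives last, so the sets of voters counted for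
  different alternatives are disjoint subsets of \<open>{1..n}\<close>.\<close>

lemma sum_last_votes_le:
  assumes "is_profile A n P" and "finite S"
  shows "(\<Sum>x\<in>S. last_votes A n P x) \<le> n"
proof -
  let ?L = "\<lambda>x. {i \<in> {1..n}. ranked_last A (P i) x}"
  have disj: "?L x \<inter> ?L y = {}" if "x \<noteq> y" for x y
  proof -
    have "antisym (P i)" if "i \<in> {1..n}" for i
      using assms(1) that
      by (simp add: is_profile_def linear_order_on_def partial_order_on_def)
    with \<open>x \<noteq> y\<close> show ?thesis
      unfolding ranked_last_def by (blast dest: antisymD)
  qed
  have "(\<Sum>x\<in>S. last_votes A n P x) = card (\<Union>x\<in>S. ?L x)"
    unfolding last_votes_def
    by (rule card_UN_disjoint [symmetric]) (use assms(2) disj in auto)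
  also have "\<dots> \<le> card {1..n}"
    by (rule card_mono) auto
  finally show ?thesis by simp
qed

lemma V_C_drops_majority_loser:
  assumes "card A \<ge> 3" and "n > 0" and prof: "is_profile A n P"
    and x: "x \<in> A" and half: "n \<le> 2 * last_votes A n P x"
  shows "x \<notin> V_C A n P"
proof -
  let ?l = "last_votes A n P"
  have fin: "finite A" using assms(1) by (intro card_ge_0_finite) linarith
  \<comment> \<open>Together \<open>x\<close> and \<open>y\<close> have at most \<open>n\<close>
    last-place votes, and \<open>x\<close> has at least half of \<open>n\<close>.\<close>
  have "?l y \<le> ?l x" for y
  proof (cases "y = x")
    case False
    then show ?thesis
      using sum_last_votes_le [OF prof, of "{x, y}"] half by simp
  qed simp
  moreover have "\<not> (\<forall>a\<in>A. \<forall>b\<in>A. ?l a = ?l b)"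
  proof
    assume eq: "\<forall>a\<in>A. \<forall>b\<in>A. ?l a = ?l b"
    \<comment> \<open>With three or more alternatives, a tie gives \<open>3 * ?l x\<close> \<le>
      \<open>n\<close> \<le> \<open>2 * ?l x\<close>, which forces \<open>n = 0\<close>.\<close>
    have "3 * ?l x \<le> card A * ?l x"
      using assms(1) by simp
    also have "\<dots> = (\<Sum>a\<in>A. ?l x)"
      by simp
    also have "\<dots> = (\<Sum>a\<in>A. ?l a)"
      by (rule sum.cong [OF refl]) (use eq x in blast)
    also have "\<dots> \<le> n"
      using prof fin by (rule sum_last_votes_le)
    finally show False
      using half \<open>n > 0\<close> by linarith
  qed
  ultimately show ?thesis
    by (simp only: V_C_def if_False Diff_iff mem_Collect_eq) blast
qed

theorem mainTheorem6:
  fixes A :: "'a set" and n :: nat and P :: "'a profile" and x :: 'a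
  assumes "finite A" and "card A \<ge> 3"
    and "n > 0"
    and "is_profile A n P"
    and "x \<in> A"
    and "real (card {i \<in> {1..n}. ranked_last A (P i) x}) \<ge> real n / 2"
  shows "x \<notin> coombs_winners A n P"
proof -
  have "n \<le> 2 * last_votes A n P x"
    using assms(6) unfolding last_votes_def by linarith
  then have "x \<notin> coombs_seq A n P 1"
    using assms(2-5) by (simp add: V_C_restrict_profile V_C_drops_majority_loser)
  \<comment> \<open>The winners are read off at index \<open>card A\<close>, which is at least 1,
    hence not before the round that removes \<open>x\<close>.\<close>
  moreover have "coombs_seq A n P (card A) \<subseteq> coombs_seq A n P 1"
    using assms(2) by (intro antimonoD [OF antimono_coombs_seq]) simp
  ultimately show ?thesis
    by (auto simp: coombs_winners_def)
qed

end
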